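(* Let $0\le\alpha<1$ and $n\ge5$. Among all strongly connected bicyclic digraphs of order $n$, $\theta(1,1,n-4)$ is the unique digraph attaining the second minimum $A_\alpha$ spectral radius and $\theta(0,2,n-4)$ is the unique digraph attaining the third minimum $A_\alpha$ spectral radius (the minimum being attained by $\theta(0,1,n-3)$).
   Context: All digraphs are simple. For a digraph $G$, $A(G)$ is its adjacency matrix and $D(G)$ the diagonal matrix of outdegrees; $A_\alpha(G)=\alpha D(G)+(1-\alpha)A(G)$ and $\lambda_\alpha(G)$ is the largest modulus of an eigenvalue of $A_\alpha(G)$. A strongly connected bicyclic digraph is a strongly connected digraph $G$ with $|E(G)|=|V(G)|+1$. For integers $0\le a\le b$, $c\ge0$ with $a+b+c+2=n$, $\theta(a,b,c)$ is the digraph with two vertices $u,v$, two internally disjoint directed paths from $v$ to $u$ having $a$ and $b$ internal vertices respectively, and a directed path from $u$ to $v$ with $c$ internal vertices, internally disjoint from the other two. *)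

theory Defs
  imports
    "Graph_Theory.Graph_Theory"
    "Jordan_Normal_Form.Spectral_Radius"
begin

text \<open>An arbitrary ordering of the vertices of a finite digraph. Any two orderings give
  permutation-similar matrices below, hence the same spectrum.\<close>

definition vertex_list :: "('a, 'b) pre_digraph \<Rightarrow> 'a list" where
  "vertex_list G = (SOME vs. distinct vs \<and> set vs = verts G)"

definition adjacency_mat :: "('a, 'b) pre_digraph \<Rightarrow> real mat" where
  "adjacency_mat G = (let vs = vertex_list G; n = length vs in
     mat n n (\<lambda>(i, j). if vs ! i \<rightarrow>\<^bsub>G\<^esub> vs ! j then 1 else 0))"

definition outdegree_mat :: "('a, 'b) pre_digraph \<Rightarrow> real mat" where
  "outdegree_mat G = (let vs = vertex_list G; n = length vs in
     mat n n (\<lambda>(i, j). if i = j then real (out_degree G (vs ! i)) else 0))"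

definition A_alpha :: "real \<Rightarrow> ('a, 'b) pre_digraph \<Rightarrow> real mat" where
  "A_alpha \<alpha> G = \<alpha> \<cdot>\<^sub>m outdegree_mat G + (1 - \<alpha>) \<cdot>\<^sub>m adjacency_mat G"

definition A_alpha_radius :: "real \<Rightarrow> ('a, 'b) pre_digraph \<Rightarrow> real" where
  "A_alpha_radius \<alpha> G = spectral_radius (map_mat complex_of_real (A_alpha \<alpha> G))"

definition sc_bicyclic :: "nat \<Rightarrow> ('a, 'b) pre_digraph \<Rightarrow> bool" where
  "sc_bicyclic n G \<longleftrightarrow> digraph G \<and> strongly_connected G \<and>
     card (verts G) = n \<and> card (arcs G) = card (verts G) + 1"

text \<open>The vertices $u$ and $v$ are 0 and 1; the internal vertices of the three paths are the
  three consecutive blocks of lengths \<open>a\<close>, \<open>b\<close>, \<open>c\<close> starting at 2.\<close>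

definition theta :: "nat \<Rightarrow> nat \<Rightarrow> nat \<Rightarrow> (nat, nat \<times> nat) pre_digraph" where
  "theta a b c = \<lparr>
     verts = {0..<a + b + c + 2},
     arcs = set (vwalk_arcs (1 # [2..<a + 2] @ [0]))
          \<union> set (vwalk_arcs (1 # [a + 2..<a + b + 2] @ [0]))
          \<union> set (vwalk_arcs (0 # [a + b + 2..<a + b + c + 2] @ [1])),
     tail = fst, head = snd \<rparr>"

text \<open>The values taken by the radius on strongly connected bicyclic digraphs of order \<open>n\<close>.
  A set comprehension needs one fixed type of digraphs; naturals as vertices and pairs as arcs
  lose nothing, see \<open>A_alpha_radius_in_radii\<close>.\<close>

definition A_alpha_radii :: "real \<Rightarrow> nat \<Rightarrow> real set" where
  "A_alpha_radii \<alpha> n =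
     {A_alpha_radius \<alpha> G | G :: (nat, nat \<times> nat) pre_digraph. sc_bicyclic n G}"

text \<open>\<open>x\<close> is the \<open>k\<close>-th smallest element of \<open>S\<close>, counting from 1.\<close>

definition kth_minimum :: "nat \<Rightarrow> real set \<Rightarrow> real \<Rightarrow> bool" where
  "kth_minimum k S x \<longleftrightarrow>
     x \<in> S \<and> finite {y \<in> S. y < x} \<and> Suc (card {y \<in> S. y < x}) = k"

lemma vertex_list:
  assumes "finite (verts G)"
  shows "distinct (vertex_list G)" "set (vertex_list G) = verts G"
  using someI_ex[of "\<lambda>vs. distinct vs \<and> set vs = verts G"] finite_distinct_list[OF assms]
  unfolding vertex_list_def by blast+

definition A_alpha_entry :: "real \<Rightarrow> ('a, 'b) pre_digraph \<Rightarrow> 'a \<Rightarrow> 'a \<Rightarrow> real" where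
  "A_alpha_entry \<alpha> G u v = \<alpha> * (if u = v then real (out_degree G u) else 0)
     + (1 - \<alpha>) * (if u \<rightarrow>\<^bsub>G\<^esub> v then 1 else 0)"

text \<open>Eigenvalues of the matrix, stated without a vertex ordering.\<close>

lemma eigenvalue_A_alpha_iff:
  fixes G :: "('a, 'b) pre_digraph"
  assumes fin: "finite (verts G)"
  shows "eigenvalue (map_mat complex_of_real (A_alpha \<alpha> G)) k \<longleftrightarrow>
    (\<exists>x :: 'a \<Rightarrow> complex. (\<exists>u \<in> verts G. x u \<noteq> 0) \<and>
      (\<forall>u \<in> verts G. (\<Sum>v \<in> verts G. of_real (A_alpha_entry \<alpha> G u v) * x v) = k * x u))"
    (is "?L \<longleftrightarrow> ?R")
proof -
  define vs where "vs = vertex_list G"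
  define n where "n = length vs"
  define A where "A = map_mat complex_of_real (A_alpha \<alpha> G)"
  have d: "distinct vs" "set vs = verts G" using vertex_list[OF fin] by (auto simp: vs_def)
  have A: "A = mat n n (\<lambda>(i, j). of_real (A_alpha_entry \<alpha> G (vs ! i) (vs ! j)))"
    unfolding A_def A_alpha_def adjacency_mat_def outdegree_mat_def Let_def vs_def[symmetric]
      n_def[symmetric]
    by (rule eq_matI) (use d in \<open>auto simp: A_alpha_entry_def n_def nth_eq_iff_index_eq\<close>)
  have dim: "dim_row A = n" by (simp add: A)
  have bij: "bij_betw (\<lambda>i. vs ! i) {0..<n} (verts G)"
    using bij_betw_nth[OF d(1), of "{0..<n}" "verts G"] d by (simp add: n_def atLeast0LessThan)
  have ex: "\<exists>i<n. u = vs ! i" if "u \<in> verts G" for u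
    using that d(2) in_set_conv_nth[of u vs] by (auto simp: n_def)
  have mem: "vs ! i \<in> verts G" if "i < n" for i using that d(2) nth_mem[of i vs] by (simp add: n_def)
  have row: "(A *\<^sub>v vec n (\<lambda>i. x (vs ! i))) $ i =
      (\<Sum>v \<in> verts G. of_real (A_alpha_entry \<alpha> G (vs ! i) v) * x v)" if i: "i < n" for x i
  proof -
    have "(A *\<^sub>v vec n (\<lambda>i. x (vs ! i))) $ i =
        (\<Sum>j = 0..<n. of_real (A_alpha_entry \<alpha> G (vs ! i) (vs ! j)) * x (vs ! j))"
      using i by (simp add: A scalar_prod_def)
    also have "\<dots> = (\<Sum>v \<in> verts G. of_real (A_alpha_entry \<alpha> G (vs ! i) v) * x v)"
      by (rule sum.reindex_bij_betw[OF bij])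
    finally show ?thesis .
  qed
  have "eigenvalue A k \<longleftrightarrow> ?R"
  proof
    assume "eigenvalue A k"
    then obtain y where y: "y \<in> carrier_vec n" "y \<noteq> 0\<^sub>v n" "A *\<^sub>v y = k \<cdot>\<^sub>v y"
      by (auto simp: eigenvalue_def eigenvector_def dim)
    define x where "x u = y $ (the_inv_into {0..<n} (\<lambda>i. vs ! i) u)" for u
    have x: "x (vs ! i) = y $ i" if "i < n" for i
      using that bij by (simp add: x_def bij_betw_def the_inv_into_f_f)
    have yx: "y = vec n (\<lambda>i. x (vs ! i))" using y(1) x by (intro eq_vecI) auto
    obtain i where "i < n" "y $ i \<noteq> 0" using y(1,2) by (metis carrier_vecD eq_vecI index_zero_vec)
    hence "\<exists>u \<in> verts G. x u \<noteq> 0" using x mem by force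
    moreover have "(\<Sum>v \<in> verts G. of_real (A_alpha_entry \<alpha> G u v) * x v) = k * x u"
      if u: "u \<in> verts G" for u
    proof -
      obtain i where i: "i < n" "u = vs ! i" using ex[OF u] by blast
      show ?thesis using row[OF i(1), of x] y(1) x[OF i(1)] i unfolding yx[symmetric] y(3) by simp
    qed
    ultimately show ?R by blast
  next
    assume ?R
    then obtain x u where x: "u \<in> verts G" "x u \<noteq> 0"
      "\<And>u. u \<in> verts G \<Longrightarrow> (\<Sum>v \<in> verts G. of_real (A_alpha_entry \<alpha> G u v) * x v) = k * x u"
      by blast
    define y where "y = vec n (\<lambda>i. x (vs ! i))"
    obtain i where "i < n" "u = vs ! i" using ex[OF x(1)] by blast
    hence "y \<noteq> 0\<^sub>v n" using x(2) by (auto simp: y_def dest!: arg_cong[of _ _ "\<lambda>v. v $ i"])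
    moreover have "A *\<^sub>v y = k \<cdot>\<^sub>v y"
      by (rule eq_vecI) (use row x(3) mem in \<open>auto simp: y_def dim\<close>)
    moreover have "y \<in> carrier_vec n" by (simp add: y_def)
    ultimately show "eigenvalue A k"
      by (auto simp: eigenvalue_def eigenvector_def dim)
  qed
  thus ?thesis by (simp add: A_def)
qed

lemma A_alpha_radius_transfer:
  fixes G :: "('a, 'b) pre_digraph" and H :: "('c, 'd) pre_digraph"
  assumes fin: "finite (verts G)" and bij: "bij_betw f (verts G) (verts H)"
    and ent: "\<And>u v. u \<in> verts G \<Longrightarrow> v \<in> verts G \<Longrightarrow>
      A_alpha_entry \<alpha> H (f u) (f v) = A_alpha_entry \<alpha> G u v"
  shows "A_alpha_radius \<alpha> H = A_alpha_radius \<alpha> G"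
proof -
  have finH: "finite (verts H)" using bij fin bij_betw_finite by blast
  have img: "verts H = f ` verts G" using bij by (simp add: bij_betw_def)
  define g where "g = the_inv_into (verts G) f"
  have g: "g (f u) = u" if "u \<in> verts G" for u
    using that bij by (simp add: g_def bij_betw_def the_inv_into_f_f)
  have "eigenvalue (map_mat complex_of_real (A_alpha \<alpha> H)) k \<longleftrightarrow>
        eigenvalue (map_mat complex_of_real (A_alpha \<alpha> G)) k" (is "?H \<longleftrightarrow> ?G") for k
  proof -
    have s: "(\<Sum>v \<in> verts H. of_real (A_alpha_entry \<alpha> H (f u) v) * x v) =
        (\<Sum>v \<in> verts G. of_real (A_alpha_entry \<alpha> G u v) * x (f v))"
      if "u \<in> verts G" for u and x :: "'c \<Rightarrow> complex"
      using that ent by (subst sum.reindex_bij_betw[OF bij, symmetric]) simp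
    show ?thesis
    proof
      assume ?H
      then obtain x where x: "\<exists>u \<in> verts H. x u \<noteq> 0"
        "\<forall>u \<in> verts H. (\<Sum>v \<in> verts H. of_real (A_alpha_entry \<alpha> H u v) * x v) = k * x u"
        unfolding eigenvalue_A_alpha_iff[OF finH] by blast
      have "(\<Sum>v \<in> verts G. of_real (A_alpha_entry \<alpha> G u v) * (x \<circ> f) v) = k * (x \<circ> f) u"
        if "u \<in> verts G" for u
        using x(2) s[OF that, of x] that by (simp add: img)
      moreover have "\<exists>u \<in> verts G. (x \<circ> f) u \<noteq> 0" using x(1) by (simp add: img)
      ultimately show ?G unfolding eigenvalue_A_alpha_iff[OF fin]
        by (intro exI[of _ "x \<circ> f"] conjI ballI)
    next
      assume ?G
      then obtain x where x: "\<exists>u \<in> verts G. x u \<noteq> 0"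
        "\<forall>u \<in> verts G. (\<Sum>v \<in> verts G. of_real (A_alpha_entry \<alpha> G u v) * x v) = k * x u"
        unfolding eigenvalue_A_alpha_iff[OF fin] by blast
      have "(\<Sum>v \<in> verts H. of_real (A_alpha_entry \<alpha> H (f u) v) * (x \<circ> g) v) = k * (x \<circ> g) (f u)"
        if "u \<in> verts G" for u
      proof -
        have "(\<Sum>v \<in> verts G. of_real (A_alpha_entry \<alpha> G u v) * (x \<circ> g) (f v)) =
            (\<Sum>v \<in> verts G. of_real (A_alpha_entry \<alpha> G u v) * x v)"
          by (rule sum.cong) (auto simp: g)
        thus ?thesis using s[OF that, of "x \<circ> g"] x(2) that by (simp add: g)
      qed
      moreover have "\<exists>u \<in> verts H. (x \<circ> g) u \<noteq> 0" using x(1) g by (auto simp: img)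
      ultimately show ?H unfolding eigenvalue_A_alpha_iff[OF finH]
        by (intro exI[of _ "x \<circ> g"]) (auto simp: img)
    qed
  qed
  hence "spectrum (map_mat complex_of_real (A_alpha \<alpha> H)) =
      spectrum (map_mat complex_of_real (A_alpha \<alpha> G))"
    by (auto simp: spectrum_def)
  thus ?thesis by (simp add: A_alpha_radius_def spectral_radius_def)
qed

lemma A_alpha_radius_in_radii:
  fixes G :: "('a, 'b) pre_digraph"
  assumes G: "sc_bicyclic n G"
  shows "A_alpha_radius \<alpha> G \<in> A_alpha_radii \<alpha> n"
proof -
  interpret digraph G using G by (simp add: sc_bicyclic_def)
  obtain f :: "'a \<Rightarrow> nat" where f: "inj_on f (verts G)"
    using finite_imp_inj_to_nat_seg[OF finite_verts] by blast
  have feq: "f u = f v \<longleftrightarrow> u = v" if "u \<in> verts G" "v \<in> verts G" for u v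
    using f that by (auto dest: inj_onD)
  define h where "h e = (f (tail G e), f (head G e))" for e
  define H where "H = \<lparr>verts = f ` verts G, arcs = h ` arcs G, tail = fst, head = snd\<rparr>"
  have h: "inj_on h (arcs G)"
    by (rule inj_onI) (auto simp: h_def feq arc_to_ends_def intro!: no_multi_arcs)
  have vH: "verts H = f ` verts G" by (simp add: H_def)
  have endsH: "arcs_ends H = map_prod f f ` arcs_ends G"
    by (auto simp: arcs_ends_def arc_to_ends_def H_def h_def image_image)
  have vG: "arcs_ends G \<subseteq> verts G \<times> verts G" by (auto simp: arcs_ends_def arc_to_ends_def)
  have dom: "f u \<rightarrow>\<^bsub>H\<^esub> f v \<longleftrightarrow> u \<rightarrow>\<^bsub>G\<^esub> v" if "u \<in> verts G" "v \<in> verts G" for u v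
  proof
    assume "f u \<rightarrow>\<^bsub>H\<^esub> f v"
    then obtain a b where ab: "(a, b) \<in> arcs_ends G" "f u = f a" "f v = f b"
      by (auto simp: endsH)
    moreover have "a \<in> verts G" "b \<in> verts G" using ab(1) vG by auto
    ultimately show "u \<rightarrow>\<^bsub>G\<^esub> v" using that by (simp add: feq)
  next
    assume "u \<rightarrow>\<^bsub>G\<^esub> v"
    thus "f u \<rightarrow>\<^bsub>H\<^esub> f v" by (auto simp: endsH intro: rev_image_eqI)
  qed
  have deg: "out_degree H (f u) = out_degree G u" if "u \<in> verts G" for u
  proof -
    have "out_arcs H (f u) = h ` out_arcs G u"
      using that by (auto simp: out_arcs_def H_def h_def feq)
    moreover have "inj_on h (out_arcs G u)" by (rule inj_on_subset[OF h]) (auto simp: out_arcs_def)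
    ultimately show ?thesis by (simp add: out_degree_def card_image)
  qed
  have "A_alpha_radius \<alpha> H = A_alpha_radius \<alpha> G"
    by (rule A_alpha_radius_transfer[of _ f])
       (use f in \<open>auto simp: A_alpha_entry_def dom deg feq bij_betw_def vH\<close>)
  moreover have "digraph H"
  proof unfold_locales
  qed (auto simp: H_def h_def feq arc_to_ends_def no_loops)
  moreover have "strongly_connected H"
  proof -
    have "(f u, f v) \<in> rtrancl_on (verts H) (arcs_ends H)"
      if "(u, v) \<in> rtrancl_on (verts G) (arcs_ends G)" for u v
      using that
    proof (induction rule: rtrancl_on.induct)
      case (rtrancl_on_refl) thus ?case by (auto simp: H_def)
    next
      case (rtrancl_on_into_rtrancl_on u v w)
      have "(f v, f w) \<in> arcs_ends H"
        using rtrancl_on_into_rtrancl_on.hyps(2) by (auto simp: endsH intro: rev_image_eqI)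
      moreover have "f w \<in> verts H" using rtrancl_on_into_rtrancl_on.hyps(3) by (simp add: vH)
      ultimately show ?case
        using rtrancl_on_into_rtrancl_on.IH by (metis rtrancl_on.rtrancl_on_into_rtrancl_on)
    qed
    thus ?thesis using G by (auto simp: sc_bicyclic_def strongly_connected_def reachable_def H_def)
  qed
  ultimately have "sc_bicyclic n H \<and> A_alpha_radius \<alpha> G = A_alpha_radius \<alpha> H"
    using G f h by (auto simp: sc_bicyclic_def H_def card_image)
  thus ?thesis unfolding A_alpha_radii_def by blast
qed

end

theory Submission
  imports Defs
begin

text \<open>In a strongly connected bicyclic digraph exactly one vertex \<open>v\<close> has outdegree 2 and all others
  have a unique successor. Following successors from the two out-neighbours of \<open>v\<close> back to \<open>v\<close> gives
  cycles of lengths \<open>i + 1\<close> and \<open>j + 1\<close>. An eigenvector is determined by its value at \<open>v\<close>, and the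
  radius is \<open>\<alpha> + (1 - \<alpha>) t\<close> where \<open>t > 1\<close> solves \<open>t = \<alpha> / (1 - \<alpha>) + t\<^sup>-\<^sup>i + t\<^sup>-\<^sup>j\<close>. Hence the radius
  depends only on \<open>{i, j}\<close> and decreases strictly in both. Since \<open>i, j \<le> n - 1\<close>, not both with
  equality, the smallest values come from \<open>{n - 2, n - 1}\<close>, \<open>{n - 2, n - 2}\<close> and \<open>{n - 3, n - 1}\<close>, the
  last two being separated by convexity; and in these two cases the pair determines the digraph.\<close>

section \<open>The equation for the rescaled radius \<open>t\<close>\<close>

text \<open>With \<open>\<beta> = \<alpha> / (1 - \<alpha>)\<close> this is the eigenvalue equation
  at the branching vertex divided by \<open>1 - \<alpha>\<close>, for the eigenvalue
  \<open>\<alpha> + (1 - \<alpha>) * t\<close>.\<close>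

definition characteristic_root :: "real \<Rightarrow> nat \<Rightarrow> nat \<Rightarrow> real \<Rightarrow> bool" where
  "characteristic_root \<beta> i j t \<longleftrightarrow> t > 1 \<and> t = \<beta> + (1 / t) ^ i + (1 / t) ^ j"

lemma characteristic_root_commute: "characteristic_root \<beta> i j t \<longleftrightarrow> characteristic_root \<beta> j i t"
  by (simp add: characteristic_root_def add_ac)

text \<open>Intermediate value theorem on \<open>{1..\<beta> + 2}\<close>: the difference of the two
  sides is negative at 1, and at \<open>\<beta> + 2\<close> each power is at most 1.\<close>

lemma characteristic_root_exists:
  assumes "\<beta> \<ge> 0"
  shows "\<exists>t. characteristic_root \<beta> i j t"
proof -
  define g where "g t = t - \<beta> - (1 / t) ^ i - (1 / t) ^ j" for t :: real
  have le1: "(1 / (\<beta> + 2)) ^ k \<le> 1" for k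
    by (rule power_le_one) (use assms in auto)
  have "\<exists>t\<ge>1. t \<le> \<beta> + 2 \<and> g t = 0"
  proof (rule IVT')
    show "g 1 \<le> 0" using assms by (simp add: g_def)
    show "0 \<le> g (\<beta> + 2)" using le1[of i] le1[of j] by (simp add: g_def)
    show "1 \<le> \<beta> + 2" using assms by simp
    show "continuous_on {1..\<beta> + 2} g" unfolding g_def by (intro continuous_intros) auto
  qed
  then obtain t where t: "t \<ge> 1" "g t = 0" by blast
  moreover have "t \<noteq> 1" using t(2) assms by (auto simp: g_def)
  ultimately have "characteristic_root \<beta> i j t"
    by (auto simp: characteristic_root_def g_def)
  thus ?thesis ..
qed

text \<open>It suffices to compare the exponent pairs at the single point \<open>u\<close>: if
  \<open>t \<ge> u\<close>, then \<open>t \<le> \<beta> + (1 / u) ^ i + (1 / u) ^ j < u\<close>,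
  because the powers of \<open>1 / t\<close> are at most those of \<open>1 / u\<close>.\<close>

lemma characteristic_root_less:
  assumes t: "characteristic_root \<beta> i j t" and u: "characteristic_root \<beta> k l u"
    and less: "(1 / u) ^ i + (1 / u) ^ j < (1 / u) ^ k + (1 / u) ^ l"
  shows "t < u"
proof (rule ccontr)
  assume "\<not> t < u"
  hence "1 / t \<le> 1 / u" "0 \<le> 1 / t" using u t by (auto simp: characteristic_root_def field_simps)
  hence "(1 / t) ^ m \<le> (1 / u) ^ m" for m by (intro power_mono)
  from this[of i] this[of j] show False
    using t u less \<open>\<not> t < u\<close> unfolding characteristic_root_def by linarith
qed

lemma characteristic_root_antimono:
  assumes t: "characteristic_root \<beta> i j t" and u: "characteristic_root \<beta> k l u"
    and "k \<le> i" "l \<le> j" "k < i \<or> l < j"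
  shows "t < u"
proof (rule characteristic_root_less[OF t u])
  have u01: "0 < 1 / u" "1 / u < 1" using u by (auto simp: characteristic_root_def)
  have le: "(1 / u) ^ b \<le> (1 / u) ^ a" if "a \<le> b" for a b
    by (rule power_decreasing) (use that u01 in auto)
  have less: "(1 / u) ^ b < (1 / u) ^ a" if "a < b" for a b
    by (rule power_strict_decreasing) (use that u01 in auto)
  show "(1 / u) ^ i + (1 / u) ^ j < (1 / u) ^ k + (1 / u) ^ l"
    using assms(3-5) le[of k i] le[of l j] less[of k i] less[of l j] by linarith
qed

text \<open>Pairs of equal sum are out of reach of \<open>characteristic_root_antimono\<close>. Here
  convexity decides: with \<open>x = 1 / u\<close> the two sums of powers differ by
  \<open>x ^ m * (1 - x) ^ 2\<close>.\<close>

lemma characteristic_root_spread: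
  assumes t: "characteristic_root \<beta> (Suc m) (Suc m) t"
    and u: "characteristic_root \<beta> m (Suc (Suc m)) u"
  shows "t < u"
proof (rule characteristic_root_less[OF t u])
  define x where "x = 1 / u"
  have x: "0 < x" "x < 1" using u by (auto simp: characteristic_root_def x_def)
  have "0 < x ^ m * (1 - x) ^ 2" using x by simp
  thus "(1 / u) ^ Suc m + (1 / u) ^ Suc m < (1 / u) ^ m + (1 / u) ^ Suc (Suc m)"
    unfolding x_def[symmetric] by (simp add: power2_eq_square algebra_simps)
qed

section \<open>Counting arcs and recognising isomorphisms\<close>

lemma (in digraph) out_degree_conv_card: "out_degree G w = card {x. w \<rightarrow> x}"
proof -
  have "{x. w \<rightarrow> x} = head G ` out_arcs G w"
    by (auto simp: arcs_ends_conv out_arcs_def)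
  moreover have "inj_on (head G) (out_arcs G w)"
    by (auto simp: inj_on_def out_arcs_def arc_to_ends_def intro: no_multi_arcs)
  ultimately show ?thesis by (simp add: out_degree_def card_image)
qed

lemma (in fin_digraph) card_arcs_conv_sum: "card (arcs G) = (\<Sum>w\<in>verts G. out_degree G w)"
proof -
  have "arcs G = (\<Union>w\<in>verts G. out_arcs G w)" by (auto simp: out_arcs_def)
  also have "card \<dots> = (\<Sum>w\<in>verts G. card (out_arcs G w))"
    by (rule card_UN_disjoint) (auto simp: out_arcs_def)
  finally show ?thesis by (simp add: out_degree_def)
qed

text \<open>Only one direction of adjacency has to be checked: the induced map on arcs is injective
  since \<open>H\<close> has no parallel arcs, and equal arc counts then make it surjective.\<close>

lemma digraph_isoI:
  assumes G: "digraph G" and H: "digraph H"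
    and inj: "inj_on f (verts H)" and img: "f ` verts H = verts G"
    and card: "card (arcs H) = card (arcs G)"
    and hom: "\<And>x y. x \<rightarrow>\<^bsub>H\<^esub> y \<Longrightarrow> f x \<rightarrow>\<^bsub>G\<^esub> f y"
  shows "digraph_iso G H"
proof -
  interpret G: digraph G by fact
  interpret H: digraph H by fact
  have "\<forall>e\<in>arcs H. \<exists>e'. e' \<in> arcs G \<and> tail G e' = f (tail H e) \<and> head G e' = f (head H e)"
    using hom by (fastforce simp: arcs_ends_conv)
  then obtain h where h: "\<forall>e\<in>arcs H. h e \<in> arcs G \<and> tail G (h e) = f (tail H e) \<and>
      head G (h e) = f (head H e)"
    by (auto dest!: bchoice)
  have hinj: "inj_on h (arcs H)"
  proof (rule inj_onI)
    fix e e' assume e: "e \<in> arcs H" "e' \<in> arcs H" "h e = h e'"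
    hence "f (tail H e) = f (tail H e')" "f (head H e) = f (head H e')" using h by metis+
    hence "arc_to_ends H e = arc_to_ends H e'"
      using e inj by (auto simp: arc_to_ends_def dest: inj_onD)
    thus "e = e'" using e H.no_multi_arcs by blast
  qed
  have himg: "h ` arcs H = arcs G"
    by (rule card_subset_eq) (use h hinj card in \<open>auto simp: card_image\<close>)
  \<comment> \<open>The fields \<open>iso_head\<close> and \<open>iso_tail\<close> become the
    endpoint maps of the image, so the image of \<open>H\<close> is \<open>G\<close> itself.\<close>
  define F where "F = \<lparr>iso_verts = f, iso_arcs = h, iso_head = head G, iso_tail = tail G\<rparr>"
  have "H.digraph_isomorphism F"
    using inj hinj h H.wf_digraph by (auto simp: H.digraph_isomorphism_def F_def)
  moreover have "G = app_iso F H" by (simp add: app_iso_def F_def img himg)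
  ultimately have "digraph_iso H G" unfolding digraph_iso_def by blast
  thus ?thesis using digraph_iso_swap H.wf_digraph by blast
qed

section \<open>Digraphs with a single branching vertex and their radius\<close>

text \<open>The vertex \<open>v\<close> is the only one of outdegree 2, and \<open>d\<close> is the distance to \<open>v\<close>. Hence the
  two cycles of the digraph have lengths \<open>d p + 1\<close> and \<open>d q + 1\<close>.\<close>

locale branching_digraph = digraph G for G :: "('a, 'b) pre_digraph" (structure) +
  fixes v p q :: 'a and s :: "'a \<Rightarrow> 'a" and d :: "'a \<Rightarrow> nat"
  assumes v_in: "v \<in> verts G"
    and p_neq_q: "p \<noteq> q"
    and dom_v: "v \<rightarrow> x \<longleftrightarrow> x = p \<or> x = q"
    and dom_s: "w \<in> verts G \<Longrightarrow> w \<noteq> v \<Longrightarrow> w \<rightarrow> x \<longleftrightarrow> x = s w"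
    and d_v: "d v = 0"
    and d_s: "w \<in> verts G \<Longrightarrow> w \<noteq> v \<Longrightarrow> d w = Suc (d (s w))"
begin

text \<open>This symmetry later allows the assumption \<open>d q \<le> d p\<close>.\<close>

lemma swap: "branching_digraph G v q p s d"
  by unfold_locales (use v_in p_neq_q dom_v dom_s d_v d_s in auto)

lemma pq_in: "p \<in> verts G" "q \<in> verts G"
  using adj_in_verts(2)[of v p] adj_in_verts(2)[of v q] by (simp_all add: dom_v)

lemma s_in: "w \<in> verts G \<Longrightarrow> w \<noteq> v \<Longrightarrow> s w \<in> verts G"
  using adj_in_verts(2)[of w "s w"] by (simp add: dom_s)

lemma out_degree_eq:
  assumes "w \<in> verts G"
  shows "out_degree G w = (if w = v then 2 else 1)"
  using assms p_neq_q by (auto simp: out_degree_conv_card dom_v dom_s Collect_disj_eq)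

lemma card_arcs: "card (arcs G) = card (verts G) + 1"
proof -
  have "card (arcs G) = (\<Sum>w\<in>verts G. 1 + (if w = v then 1 else 0))"
    unfolding card_arcs_conv_sum by (rule sum.cong) (auto simp: out_degree_eq)
  also have "\<dots> = card (verts G) + 1" using v_in unfolding sum.distrib by simp
  finally show ?thesis .
qed

lemma row_sum:
  fixes x :: "'a \<Rightarrow> complex"
  assumes w: "w \<in> verts G"
  shows "(\<Sum>y\<in>verts G. of_real (A_alpha_entry \<alpha> G w y) * x y) =
    (if w = v then 2 * of_real \<alpha> * x v + (1 - of_real \<alpha>) * (x p + x q)
     else of_real \<alpha> * x w + (1 - of_real \<alpha>) * x (s w))"
proof -
  have "(\<Sum>y\<in>verts G. of_real (A_alpha_entry \<alpha> G w y) * x y) =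
      (\<Sum>y\<in>verts G. (if w = y then of_real \<alpha> * of_nat (out_degree G w) * x w else 0)
        + (if w \<rightarrow> y then (1 - of_real \<alpha>) * x y else 0))"
    by (rule sum.cong) (auto simp: A_alpha_entry_def algebra_simps)
  also have "\<dots> = of_real \<alpha> * of_nat (out_degree G w) * x w
      + (1 - of_real \<alpha>) * (\<Sum>y\<in>{y\<in>verts G. w \<rightarrow> y}. x y)"
    using w unfolding sum_distrib_left by (simp add: sum.distrib sum.inter_filter)
  also have "{y\<in>verts G. w \<rightarrow> y} = (if w = v then {p, q} else {s w})"
    using w pq_in s_in by (auto simp: dom_v dom_s)
  finally show ?thesis using w p_neq_q by (auto simp: out_degree_eq)
qed

text \<open>Away from \<open>v\<close> an eigenvector is multiplied by a constant factor at each
  step along \<open>s\<close>, so only the equation at \<open>v\<close> restricts the eigenvalue. It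
  holds for \<open>r\<close> by the choice of \<open>t\<close> and fails for every \<open>k\<close>
  of modulus above \<open>r\<close>.\<close>

lemma radius_eq:
  assumes \<alpha>: "0 \<le> \<alpha>" "\<alpha> < 1" and t: "characteristic_root (\<alpha> / (1 - \<alpha>)) (d p) (d q) t"
  shows "A_alpha_radius \<alpha> G = \<alpha> + (1 - \<alpha>) * t"
proof -
  define A where "A = map_mat complex_of_real (A_alpha \<alpha> G)"
  define r where "r = \<alpha> + (1 - \<alpha>) * t"
  have t1: "t > 1" and teq: "t = \<alpha> / (1 - \<alpha>) + (1 / t) ^ d p + (1 / t) ^ d q"
    using t by (auto simp: characteristic_root_def)
  have req: "r - 2 * \<alpha> = (1 - \<alpha>) * ((1 / t) ^ d p + (1 / t) ^ d q)"
    using \<alpha> teq by (simp add: r_def field_simps)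
  have r0: "r > \<alpha>" using \<alpha> t1 by (simp add: r_def)
  have ev: "eigenvalue A k \<longleftrightarrow> (\<exists>x :: 'a \<Rightarrow> complex. (\<exists>u \<in> verts G. x u \<noteq> 0) \<and>
      (\<forall>u \<in> verts G. (\<Sum>y \<in> verts G. of_real (A_alpha_entry \<alpha> G u y) * x y) = k * x u))" for k
    unfolding A_def by (rule eigenvalue_A_alpha_iff) simp
  have "eigenvalue A (of_real r)"
    unfolding ev
  proof (intro exI conjI ballI)
    \<comment> \<open>Each step towards \<open>v\<close> multiplies the entry by \<open>t\<close>;
      the entry at \<open>v\<close> is normalised to 1.\<close>
    let ?x = "\<lambda>w. complex_of_real ((1 / t) ^ d w)"
    show "\<exists>u\<in>verts G. ?x u \<noteq> 0" using v_in t1 by (intro bexI[of _ v]) auto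
    fix w assume w: "w \<in> verts G"
    have "2 * \<alpha> + (1 - \<alpha>) * ((1 / t) ^ d p + (1 / t) ^ d q) = r" using req by simp
    moreover have "\<alpha> * (1 / t) ^ Suc m + (1 - \<alpha>) * (1 / t) ^ m = r * (1 / t) ^ Suc m" for m
      using t1 by (simp add: r_def field_simps)
    ultimately have "(if w = v then 2 * \<alpha> * (1 / t) ^ d v + (1 - \<alpha>) * ((1 / t) ^ d p + (1 / t) ^ d q)
        else \<alpha> * (1 / t) ^ d w + (1 - \<alpha>) * (1 / t) ^ d (s w)) = r * (1 / t) ^ d w"
      using d_s[OF w] d_v by auto
    from arg_cong[OF this, of complex_of_real]
    show "(\<Sum>y\<in>verts G. of_real (A_alpha_entry \<alpha> G w y) * ?x y) = of_real r * ?x w"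
      unfolding row_sum[OF w] by (simp split: if_splits)
  qed
  moreover have "norm k \<le> r" if "eigenvalue A k" for k
  proof (rule ccontr)
    assume less: "\<not> norm k \<le> r"
    from \<open>eigenvalue A k\<close>[unfolded ev] obtain x :: "'a \<Rightarrow> complex"
      where x0: "\<exists>u\<in>verts G. x u \<noteq> 0" and x: "\<forall>w\<in>verts G.
        (\<Sum>y \<in> verts G. of_real (A_alpha_entry \<alpha> G w y) * x y) = k * x w"
      by (elim exE conjE) (rule that)
    note x = x[rule_format]
    obtain u where u: "u \<in> verts G" "x u \<noteq> 0" using x0 by (elim bexE) (rule that)
    \<comment> \<open>Rescaling \<open>k\<close> as \<open>r\<close> is rescaled to
      \<open>t\<close>: \<open>k = \<alpha> + (1 - \<alpha>) * z\<close>, so that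
      \<open>norm k > r\<close> forces \<open>norm z > t\<close>.\<close>
    define z where "z = (k - of_real \<alpha>) / (1 - of_real \<alpha>)"
    have "1 - complex_of_real \<alpha> = of_real (1 - \<alpha>)" by simp
    hence "norm (1 - complex_of_real \<alpha>) = \<bar>1 - \<alpha>\<bar>" by (metis norm_of_real)
    hence \<alpha>c: "1 - complex_of_real \<alpha> \<noteq> 0" "norm (1 - complex_of_real \<alpha>) = 1 - \<alpha>"
      using \<alpha> by auto
    have k: "k - of_real \<alpha> = (1 - of_real \<alpha>) * z" using \<alpha>c by (simp add: z_def)
    have "norm k - \<alpha> \<le> norm (k - of_real \<alpha>)"
      using norm_triangle_ineq2[of k "of_real \<alpha>"] \<alpha> by simp
    hence "(1 - \<alpha>) * t < norm (k - of_real \<alpha>)" using less by (simp add: r_def)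
    also have "\<dots> = (1 - \<alpha>) * norm z" using \<alpha>c k by (simp add: norm_mult)
    finally have zt: "norm z > t" using \<alpha> by simp
    have z0: "z \<noteq> 0" using zt t1 by auto
    \<comment> \<open>The row of \<open>w \<noteq> v\<close> reads \<open>z * x w = x (s w)\<close>;
      this is iterated over the \<open>d w\<close> steps to \<open>v\<close>.\<close>
    have xz: "x w = (1 / z) ^ d w * x v" if "w \<in> verts G" for w
      using that
    proof (induction "d w" arbitrary: w)
      case 0
      hence "w = v" using d_s[of w] by fastforce
      thus ?case using 0 by simp
    next
      case (Suc m)
      hence wv: "w \<noteq> v" using d_v by auto
      have "(k - of_real \<alpha>) * x w = (1 - of_real \<alpha>) * x (s w)"
        using x[OF Suc.prems] wv unfolding row_sum[OF Suc.prems] by (simp add: algebra_simps)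
      hence "z * x w = x (s w)" using \<alpha>c unfolding k by simp
      moreover have "x (s w) = (1 / z) ^ d (s w) * x v"
        using Suc d_s[OF Suc.prems wv] s_in[OF Suc.prems wv] by simp
      ultimately show ?case using z0 d_s[OF Suc.prems wv] by (simp add: field_simps)
    qed
    have xv: "x v \<noteq> 0" using xz[OF u(1)] u(2) by auto
    \<comment> \<open>The equation at \<open>v\<close> now bounds
      \<open>norm (k - 2 * of_real \<alpha>)\<close> by \<open>r - 2 * \<alpha>\<close>, whereas the
      triangle inequality makes it larger.\<close>
    have "(k - 2 * of_real \<alpha>) * x v = (1 - of_real \<alpha>) * ((1 / z) ^ d p + (1 / z) ^ d q) * x v"
      using x[OF v_in] xz[OF pq_in(1)] xz[OF pq_in(2)] unfolding row_sum[OF v_in]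
      by (simp add: algebra_simps)
    hence "norm (k - 2 * of_real \<alpha>) = (1 - \<alpha>) * norm ((1 / z) ^ d p + (1 / z) ^ d q)"
      using xv \<alpha>c by (simp add: norm_mult)
    also have "\<dots> \<le> (1 - \<alpha>) * ((1 / norm z) ^ d p + (1 / norm z) ^ d q)"
      using \<alpha> norm_triangle_ineq[of "(1 / z) ^ d p" "(1 / z) ^ d q"]
      by (intro mult_left_mono) (auto simp: norm_divide norm_power)
    also have "\<dots> \<le> (1 - \<alpha>) * ((1 / t) ^ d p + (1 / t) ^ d q)"
      using \<alpha> zt t1 z0
      by (intro mult_left_mono add_mono power_mono divide_left_mono mult_pos_pos) auto
    also have "\<dots> = r - 2 * \<alpha>" using req by simp
    finally have "norm (k - 2 * of_real \<alpha>) \<le> r - 2 * \<alpha>" .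
    moreover have "norm k - 2 * \<alpha> \<le> norm (k - 2 * of_real \<alpha>)"
      using norm_triangle_ineq2[of k "2 * of_real \<alpha>"] \<alpha> by (simp add: norm_mult)
    ultimately show False using less by simp
  qed
  moreover have "A \<in> carrier_mat (dim_row A) (dim_row A)"
    by (auto simp: A_def A_alpha_def adjacency_mat_def outdegree_mat_def Let_def)
  hence "finite (spectrum A)" by (rule card_finite_spectrum)
  ultimately have "Max (norm ` spectrum A) = r"
    using r0 \<alpha> by (intro Max_eqI) (auto simp: spectrum_def intro!: image_eqI[of _ _ "of_real r"])
  thus ?thesis by (simp add: A_alpha_radius_def spectral_radius_def A_def r_def)
qed

text \<open>The bound \<open>i \<le> d w\<close> keeps the iteration from stepping beyond
  \<open>v\<close>, where \<open>s\<close> is unspecified.\<close>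

lemma funpow_s:
  assumes "w \<in> verts G" "i \<le> d w"
  shows "(s ^^ i) w \<in> verts G \<and> d ((s ^^ i) w) = d w - i"
  using assms(2)
proof (induction i)
  case (Suc i)
  hence IH: "(s ^^ i) w \<in> verts G" "d ((s ^^ i) w) = d w - i" by auto
  hence "(s ^^ i) w \<noteq> v" using Suc.prems d_v by auto
  thus ?case using IH s_in[OF IH(1)] d_s[OF IH(1)] by simp
qed (use assms in simp)

lemma d_eq_0_iff: "w \<in> verts G \<Longrightarrow> d w = 0 \<longleftrightarrow> w = v"
  using d_v d_s by fastforce

lemma inj_on_orbit: "w \<in> verts G \<Longrightarrow> inj_on (\<lambda>i. (s ^^ i) w) {..d w}"
  by (rule inj_onI) (metis atMost_iff diff_diff_cancel funpow_s)

text \<open>The path from \<open>w\<close> to \<open>v\<close> consists of \<open>d w + 1\<close>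
  distinct vertices, told apart by their distances.\<close>

lemma d_less_card:
  assumes "w \<in> verts G"
  shows "d w < card (verts G)"
proof -
  have "card {..d w} \<le> card (verts G)"
    by (rule card_inj_on_le[OF inj_on_orbit[OF assms]]) (use funpow_s assms in auto)
  thus ?thesis by simp
qed

text \<open>The path from \<open>w\<close> to \<open>v\<close> exhausts the vertices, so each vertex
  is determined by its distance.\<close>

lemma orbit_spanning:
  assumes w: "w \<in> verts G" and "Suc (d w) = card (verts G)" and x: "x \<in> verts G"
  shows "x = (s ^^ (d w - d x)) w"
proof -
  have "(\<lambda>i. (s ^^ i) w) ` {..d w} = verts G"
    by (rule card_subset_eq) (use funpow_s assms card_image[OF inj_on_orbit[OF w]] in auto)
  then obtain i where "i \<le> d w" "x = (s ^^ i) w" using x by auto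
  thus ?thesis using funpow_s[OF w] by (metis diff_diff_cancel)
qed

text \<open>Otherwise the path from \<open>p\<close> is spanning and contains \<open>q\<close> at
  the same distance as \<open>p\<close>, which gives \<open>q = p\<close>.\<close>

lemma d_not_both_maximal: "Suc (d p) < card (verts G) \<or> Suc (d q) < card (verts G)"
proof (rule ccontr)
  assume "\<not> ?thesis"
  hence "Suc (d p) = card (verts G)" "Suc (d q) = card (verts G)"
    using d_less_card pq_in by fastforce+
  hence "q = (s ^^ (d p - d q)) p" "d p = d q" using orbit_spanning[of p q] pq_in by simp_all
  thus False using p_neq_q by simp
qed

end

section \<open>From strongly connected bicyclic digraphs to branching digraphs\<close>

text \<open>Strong connectivity makes all outdegrees positive, and the arc count leaves a total
  excess of 1, which falls on one vertex \<open>v\<close>. The distance is the first time at which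
  iterating \<open>s\<close> hits \<open>v\<close>.\<close>

lemma sc_bicyclic_branching:
  fixes G :: "('a, 'b) pre_digraph" (structure)
  assumes G: "sc_bicyclic n G" and n: "n \<ge> 2"
  shows "\<exists>v p q s d. branching_digraph G v p q s d"
proof -
  interpret digraph G using G by (simp add: sc_bicyclic_def)
  have sc: "strongly_connected G" and cV: "card (verts G) = n" and cA: "card (arcs G) = n + 1"
    using G by (auto simp: sc_bicyclic_def)
  have pos: "out_degree G w \<ge> 1" if w: "w \<in> verts G" for w
  proof -
    have "\<not> verts G \<subseteq> {w}" using cV n card_mono[of "{w}" "verts G"] by auto
    then obtain y where y: "y \<in> verts G" "y \<noteq> w" by auto
    have "w \<rightarrow>\<^sup>* y" using sc w y by (auto simp: strongly_connected_def)
    then obtain x where "w \<rightarrow> x"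
      unfolding reachable_def by (cases rule: converse_rtrancl_on_cases) (use y in auto)
    moreover have "finite {x. w \<rightarrow> x}" by (rule finite_subset[of _ "verts G"]) auto
    ultimately show ?thesis unfolding out_degree_conv_card
      by (metis One_nat_def Suc_leI card_gt_0_iff empty_iff mem_Collect_eq)
  qed
  have "(\<Sum>w\<in>verts G. out_degree G w - 1) = (\<Sum>w\<in>verts G. out_degree G w) - (\<Sum>w\<in>verts G. 1)"
    by (rule sum_subtractf_nat) (use pos in auto)
  hence excess: "(\<Sum>w\<in>verts G. out_degree G w - 1) = 1"
    using card_arcs_conv_sum cA cV by simp
  then obtain v where v: "v \<in> verts G" "out_degree G v - 1 = 1"
    "\<And>w. w \<in> verts G \<Longrightarrow> w \<noteq> v \<Longrightarrow> out_degree G w - 1 = 0"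
    by (subst (asm) sum_eq_1_iff) auto
  have "card {x. v \<rightarrow> x} = 2" using v by (simp flip: out_degree_conv_card)
  then obtain p q where pq: "{x. v \<rightarrow> x} = {p, q}" "p \<noteq> q" by (auto simp: card_2_iff)
  have "\<exists>y. {x. w \<rightarrow> x} = {y}" if "w \<in> verts G" "w \<noteq> v" for w
  proof -
    have "card {x. w \<rightarrow> x} = 1" using v(3)[OF that] pos[OF that(1)] by (simp flip: out_degree_conv_card)
    thus ?thesis by (simp add: card_1_singleton_iff)
  qed
  then obtain s where s: "\<And>w. w \<in> verts G \<Longrightarrow> w \<noteq> v \<Longrightarrow> {x. w \<rightarrow> x} = {s w}" by metis
  \<comment> \<open>Backward induction along a walk to \<open>v\<close>. Where the walk meets
    \<open>v\<close> early, the count restarts at 0; elsewhere the next vertex has to be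
    \<open>s x\<close>.\<close>
  have ex: "\<exists>i. (s ^^ i) w = v" if "w \<in> verts G" for w
  proof -
    have "(w, v) \<in> rtrancl_on (verts G) (arcs_ends G)"
      using sc that v(1) by (auto simp: strongly_connected_def reachable_def)
    thus ?thesis
    proof (induction rule: converse_rtrancl_on_induct)
      case base
      show ?case by (rule exI[of _ 0]) simp
    next
      case (step x y)
      then obtain i where i: "(s ^^ i) y = v" by blast
      show ?case
      proof (cases "x = v")
        case True
        thus ?thesis by (intro exI[of _ 0]) simp
      next
        case False
        hence "y = s x" using s[of x] step.hyps by auto
        thus ?thesis using i by (intro exI[of _ "Suc i"]) (simp add: funpow_swap1)
      qed
    qed
  qed
  define d where "d w = (LEAST i. (s ^^ i) w = v)" for w
  have "branching_digraph G v p q s d"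
  proof unfold_locales
    show "d v = 0" by (simp add: d_def)
    fix w assume w: "w \<in> verts G" "w \<noteq> v"
    obtain i where "(s ^^ i) w = v" using ex w by blast
    hence "(LEAST i. (s ^^ i) w = v) = Suc (LEAST i. (s ^^ Suc i) w = v)"
      by (rule Least_Suc) (use w in simp)
    thus "d w = Suc (d (s w))" by (simp add: d_def funpow_swap1)
  qed (use v pq s in auto)
  thus ?thesis by blast
qed

section \<open>The theta digraphs as branching digraphs\<close>

text \<open>Meaningful only away from the branching vertex 1. The order of the tests matters: for
  \<open>c = 0\<close> the vertex \<open>a + b + c + 1\<close> is the end of a path into 0, not into
  1.\<close>

definition theta_succ :: "nat \<Rightarrow> nat \<Rightarrow> nat \<Rightarrow> nat \<Rightarrow> nat" where
  "theta_succ a b c w =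
     (if w = 0 then (if c = 0 then 1 else a + b + 2)
      else if w = a + 1 \<or> w = a + b + 1 then 0
      else if w = a + b + c + 1 then 1
      else Suc w)"

text \<open>The number of successor steps to 1; a vertex of the first two blocks first reaches 0 and
  then needs \<open>c + 1\<close> more steps.\<close>

definition theta_dist :: "nat \<Rightarrow> nat \<Rightarrow> nat \<Rightarrow> nat \<Rightarrow> nat" where
  "theta_dist a b c w =
     (if w = 0 then c + 1
      else if w = 1 then 0
      else if w < a + 2 then c + a + 3 - w
      else if w < a + b + 2 then c + a + b + 3 - w
      else a + b + c + 2 - w)"

text \<open>Induction on the block length: the first block vertex \<open>m\<close> takes over the
  role of \<open>x\<close>. An empty block leaves the single arc from \<open>x\<close> to
  \<open>y\<close>.\<close>

lemma vwalk_arcs_upt_iff: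
  "(u, w) \<in> set (vwalk_arcs (x # [m..<m + k] @ [y])) \<longleftrightarrow>
     (if k = 0 then u = x \<and> w = y
      else u = x \<and> w = m \<or> Suc u = m + k \<and> w = y \<or> m \<le> u \<and> Suc u < m + k \<and> w = Suc u)"
proof (induction k arbitrary: x m)
  case (Suc k)
  have "[m..<m + Suc k] = m # [Suc m..<Suc m + k]" by (simp add: upt_rec)
  hence step: "(u, w) \<in> set (vwalk_arcs (x # [m..<m + Suc k] @ [y])) \<longleftrightarrow>
      u = x \<and> w = m \<or> (u, w) \<in> set (vwalk_arcs (m # [Suc m..<Suc m + k] @ [y]))" by simp
  show ?case unfolding step Suc.IH by (cases "u = m"; cases "k = 0"; simp; linarith?)
qed simp

lemma theta_arc_iff:
  "(x, y) \<in> arcs (theta a b c) \<longleftrightarrow>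
     x < a + b + c + 2 \<and> x \<noteq> 1 \<and> y = theta_succ a b c x \<or>
     x = 1 \<and> (y = (if a = 0 then 0 else 2) \<or> y = (if b = 0 then 0 else a + 2))"
proof -
  have arcs: "arcs (theta a b c) = set (vwalk_arcs (1 # [2..<2 + a] @ [0])) \<union>
      set (vwalk_arcs (1 # [a + 2..<(a + 2) + b] @ [0])) \<union>
      set (vwalk_arcs (0 # [a + b + 2..<(a + b + 2) + c] @ [1]))"
    by (simp add: theta_def add_ac)
  have *: "(x, y) \<in> arcs (theta a b c) \<longleftrightarrow>
      (if a = 0 then x = 1 \<and> y = 0 else x = 1 \<and> y = 2 \<or> x = a + 1 \<and> y = 0 \<or>
         2 \<le> x \<and> x < a + 1 \<and> y = Suc x) \<or>
      (if b = 0 then x = 1 \<and> y = 0 else x = 1 \<and> y = a + 2 \<or> x = a + b + 1 \<and> y = 0 \<or>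
         a + 2 \<le> x \<and> x < a + b + 1 \<and> y = Suc x) \<or>
      (if c = 0 then x = 0 \<and> y = 1 else x = 0 \<and> y = a + b + 2 \<or> x = a + b + c + 1 \<and> y = 1 \<or>
         a + b + 2 \<le> x \<and> x < a + b + c + 1 \<and> y = Suc x)"
    unfolding arcs Un_iff vwalk_arcs_upt_iff by (simp add: eval_nat_numeral)
  \<comment> \<open>The two end vertices of the paths, then the interior and the last vertex of each
    block.\<close>
  consider "x = 0" | "x = 1" | "2 \<le> x" "x < a + 1" | "2 \<le> x" "x = a + 1"
    | "a + 2 \<le> x" "x < a + b + 1" | "a + 2 \<le> x" "x = a + b + 1"
    | "a + b + 2 \<le> x" "x < a + b + c + 1" | "a + b + 2 \<le> x" "x = a + b + c + 1"
    | "x \<ge> a + b + c + 2"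
    by linarith
  thus ?thesis unfolding * theta_succ_def by cases (simp_all, linarith?)
qed

lemma theta_simps [simp]:
  "verts (theta a b c) = {0..<a + b + c + 2}" "tail (theta a b c) = fst" "head (theta a b c) = snd"
  by (simp_all add: theta_def)

lemma arcs_ends_theta [simp]: "arcs_ends (theta a b c) = arcs (theta a b c)"
  by (simp add: arcs_ends_def arc_to_ends_def)

text \<open>The assumption excludes \<open>a = b = 0\<close>, where both out-neighbours of 1 would
  be 0.\<close>

lemma branching_digraph_theta:
  assumes "a + b > 0"
  shows "branching_digraph (theta a b c) 1 (if a = 0 then 0 else 2) (if b = 0 then 0 else a + 2)
    (theta_succ a b c) (theta_dist a b c)"
proof unfold_locales
  show "finite (arcs (theta a b c))" by (simp add: theta_def)
  fix e assume e: "e \<in> arcs (theta a b c)"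
  obtain x y where xy: "e = (x, y)" by force
  show "tail (theta a b c) e \<in> verts (theta a b c)"
    "head (theta a b c) e \<in> verts (theta a b c)" "tail (theta a b c) e \<noteq> head (theta a b c) e"
    using e unfolding xy theta_arc_iff by (auto simp: theta_succ_def split: if_splits)
next
  show "(if a = 0 then 0 else 2) \<noteq> (if b = 0 then 0 else a + 2)" using assms by auto
  show "theta_dist a b c w = Suc (theta_dist a b c (theta_succ a b c w))"
    if "w \<in> verts (theta a b c)" "w \<noteq> 1" for w
    using that by (auto simp: theta_dist_def theta_succ_def)
qed (auto simp: theta_arc_iff theta_dist_def arc_to_ends_def)

text \<open>Every vertex reaches 1 along successors, and is reached from 1 by tracing predecessors
  of decreasing rank \<open>r\<close>.\<close>

lemma strongly_connected_theta:
  assumes "a + b > 0"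
  shows "strongly_connected (theta a b c)"
proof -
  interpret branching_digraph "theta a b c" 1 "if a = 0 then 0 else 2" "if b = 0 then 0 else a + 2"
    "theta_succ a b c" "theta_dist a b c"
    by (rule branching_digraph_theta[OF assms])
  have to: "w \<rightarrow>\<^sup>*\<^bsub>theta a b c\<^esub> 1" if "w \<in> verts (theta a b c)" for w
    using that
  proof (induction "theta_dist a b c w" arbitrary: w rule: less_induct)
    case less
    show ?case
    proof (cases "w = 1")
      case False
      hence "w \<rightarrow>\<^bsub>theta a b c\<^esub> theta_succ a b c w" using dom_s less.prems by blast
      moreover have "theta_succ a b c w \<rightarrow>\<^sup>*\<^bsub>theta a b c\<^esub> 1"
        using less s_in d_s False by simp
      ultimately show ?thesis by (rule adj_reachable_trans)
    qed (use less in auto)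
  qed
  \<comment> \<open>The rank orders the vertices as 1, the first two blocks, 0, the third
    block.\<close>
  define r where "r w = (if w = 0 then a + b + 2 else if w = 1 then 0
    else if w < a + b + 2 then w else w + 1)" for w :: nat
  have pred: "\<exists>w'. w' \<rightarrow>\<^bsub>theta a b c\<^esub> w \<and> r w' < r w" if "w \<in> verts (theta a b c)" "w \<noteq> 1" for w
  proof -
    have w: "w < a + b + c + 2" "w \<noteq> 1" using that by simp_all
    consider "w = 0" | "2 \<le> w" "w < a + b + 2" "w = 2 \<or> w = a + 2"
      | "2 < w" "w < a + b + 2" "w \<noteq> a + 2" | "w = a + b + 2" | "w > a + b + 2"
      using w by linarith
    thus ?thesis
    proof cases
      case 1
      \<comment> \<open>The last vertex of the first block, or 1 itself when that block is
        empty.\<close>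
      thus ?thesis using w assms by (intro exI[of _ "a + 1"])
        (auto simp: theta_arc_iff theta_succ_def r_def)
    next
      case 2
      thus ?thesis using w assms by (intro exI[of _ 1])
        (auto simp: theta_arc_iff theta_succ_def r_def)
    next
      case 3
      thus ?thesis using w assms by (intro exI[of _ "w - 1"])
        (auto simp: theta_arc_iff theta_succ_def r_def)
    next
      case 4
      thus ?thesis using w assms by (intro exI[of _ 0])
        (auto simp: theta_arc_iff theta_succ_def r_def)
    next
      case 5
      thus ?thesis using w assms by (intro exI[of _ "w - 1"])
        (auto simp: theta_arc_iff theta_succ_def r_def)
    qed
  qed
  have "1 \<rightarrow>\<^sup>*\<^bsub>theta a b c\<^esub> w" if "w \<in> verts (theta a b c)" for w
    using that
  proof (induction "r w" arbitrary: w rule: less_induct)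
    case less
    show ?case
    proof (cases "w = 1")
      case False
      then obtain w' where w': "w' \<rightarrow>\<^bsub>theta a b c\<^esub> w" "r w' < r w" using pred less.prems by blast
      moreover have "w' \<in> verts (theta a b c)" using w'(1) by (rule adj_in_verts)
      ultimately show ?thesis using less.hyps reachable_adj_trans by blast
    qed (use less in auto)
  qed
  thus ?thesis using to reachable_trans unfolding strongly_connected_def
    by (metis empty_iff v_in)
qed

lemma sc_bicyclic_theta:
  assumes "a + b > 0"
  shows "sc_bicyclic (a + b + c + 2) (theta a b c)"
proof -
  interpret branching_digraph "theta a b c" 1 "if a = 0 then 0 else 2" "if b = 0 then 0 else a + 2"
    "theta_succ a b c" "theta_dist a b c"
    by (rule branching_digraph_theta[OF assms])
  show ?thesis using strongly_connected_theta[OF assms] card_arcs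
    by (simp add: sc_bicyclic_def digraph_axioms)
qed

lemma A_alpha_radius_theta:
  assumes "0 \<le> \<alpha>" "\<alpha> < 1" "a + b > 0"
    and "characteristic_root (\<alpha> / (1 - \<alpha>)) (a + c + 1) (b + c + 1) t"
  shows "A_alpha_radius \<alpha> (theta a b c) = \<alpha> + (1 - \<alpha>) * t"
proof -
  interpret branching_digraph "theta a b c" 1 "if a = 0 then 0 else 2" "if b = 0 then 0 else a + 2"
    "theta_succ a b c" "theta_dist a b c"
    by (rule branching_digraph_theta[OF assms(3)])
  have "theta_dist a b c (if a = 0 then 0 else 2) = a + c + 1"
    "theta_dist a b c (if b = 0 then 0 else a + 2) = b + c + 1"
    by (auto simp: theta_dist_def)
  thus ?thesis using radius_eq[of \<alpha> t] assms by simp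
qed

section \<open>Distance pairs that determine the digraph\<close>

context branching_digraph
begin

text \<open>The path from \<open>p\<close> to \<open>v\<close> has \<open>n - 1\<close> vertices and
  misses only \<open>q\<close>. Being at distance \<open>n - 3\<close>, \<open>s q\<close> must be
  \<open>s p\<close>, and then all arcs are known.\<close>

lemma iso_theta_1_1:
  assumes n: "n \<ge> 5" "card (verts G) = n" and d: "d p = n - 2" "d q = n - 2"
  shows "digraph_iso G (theta 1 1 (n - 4))"
proof -
  \<comment> \<open>The one-vertex blocks 2 and 3 go to \<open>p\<close> and \<open>q\<close>, and
    the third block, starting at 4, continues the path beyond \<open>s p\<close>.\<close>
  define f where "f x = (if x = 0 then s p else if x = 1 then v else if x = 3 then q
    else (s ^^ (x - 2)) p)" for x :: nat
  have pv: "p \<noteq> v" "q \<noteq> v" using d d_v n by auto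
  have f: "f x \<in> verts G \<and> d (f x) = (if x = 0 then n - 3 else if x = 1 then 0
      else if x = 2 \<or> x = 3 then n - 2 else n - x)" if "x < n" for x
    using that funpow_s[OF pq_in(1), of "x - 2"] s_in[OF pq_in(1)] d_s[OF pq_in(1)] pv d d_v v_in pq_in n
    by (auto simp: f_def)
  have f23: "f 2 = p" "f 3 = q" by (simp_all add: f_def)
  have inj: "inj_on f {0..<n}"
  proof (rule inj_onI)
    fix x y assume xy: "x \<in> {0..<n}" "y \<in> {0..<n}" "f x = f y"
    hence "d (f x) = d (f y)" by simp
    \<comment> \<open>Distances separate all images except those of 2 and 3.\<close>
    hence "x = y \<or> {x, y} = {2, 3}" using f[of x] f[of y] xy n by (auto split: if_splits)
    thus "x = y" using xy f23 p_neq_q by (auto simp: doubleton_eq_iff)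
  qed
  have img: "f ` {0..<n} = verts G"
    by (rule card_subset_eq) (use f n card_image[OF inj] in auto)
  have "s q \<in> verts G" using s_in pq_in pv by blast
  then obtain x where x: "x < n" "s q = f x" unfolding img[symmetric] by auto
  hence "d (f x) = n - 3" using d_s[OF pq_in(2) pv(2)] d by simp
  hence "x = 0" using f[OF x(1)] n x(1) by (auto split: if_splits)
  hence sq: "s q = s p" using x by (simp add: f_def)
  have N: "1 + 1 + (n - 4) + 2 = n" using n by simp
  have sf: "f y = s (f x)" if x: "x < n" "x \<noteq> 1" "y = theta_succ 1 1 (n - 4) x" for x y
  proof -
    consider "x = 0" | "x = 2" | "x = 3" | "4 \<le> x" "x < n - 1" | "4 \<le> x" "x = n - 1"
      using x(1,2) n(1) by linarith
    thus ?thesis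
    proof cases
      case 4
      hence "y = Suc x" using x n by (auto simp: theta_succ_def)
      moreover have "Suc x - 2 = Suc (x - 2)" using 4 by simp
      ultimately show ?thesis using 4 by (simp add: f_def)
    next
      case 5
      have fx: "f x \<in> verts G" "d (f x) = 1" using f[OF x(1)] 5 n(1) by auto
      hence "f x \<noteq> v" using d_v by auto
      hence "d (s (f x)) = 0" "s (f x) \<in> verts G"
        using d_s[OF fx(1)] s_in[OF fx(1)] fx(2) by auto
      hence "s (f x) = v" by (simp add: d_eq_0_iff)
      thus ?thesis using x 5 n by (simp add: f_def theta_succ_def)
    qed (use x n sq in \<open>auto simp: f_def theta_succ_def numeral_2_eq_2\<close>)
  qed
  show ?thesis
  proof (rule digraph_isoI[where f = f])
    show "digraph G" by (rule digraph_axioms)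
    show "digraph (theta 1 1 (n - 4))" "card (arcs (theta 1 1 (n - 4))) = card (arcs G)"
      using sc_bicyclic_theta[of 1 1 "n - 4"] card_arcs n by (auto simp: sc_bicyclic_def)
    show "inj_on f (verts (theta 1 1 (n - 4)))" "f ` verts (theta 1 1 (n - 4)) = verts G"
      unfolding theta_simps N by (fact inj, fact img)
    fix x y assume "x \<rightarrow>\<^bsub>theta 1 1 (n - 4)\<^esub> y"
    hence "x < n \<and> x \<noteq> 1 \<and> y = theta_succ 1 1 (n - 4) x \<or> x = 1 \<and> (y = 2 \<or> y = 3)"
      unfolding arcs_ends_theta theta_arc_iff N by auto
    thus "f x \<rightarrow> f y"
    proof (elim disjE conjE)
      assume x: "x < n" "x \<noteq> 1" "y = theta_succ 1 1 (n - 4) x"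
      hence "f x \<in> verts G" "f x \<noteq> v" using f[of x] n d_v by (auto split: if_splits)
      thus ?thesis using sf[OF x] dom_s by simp
    qed (auto simp: f_def dom_v)
  qed
qed

text \<open>The path from \<open>p\<close> to \<open>v\<close> is spanning, so \<open>q\<close>, at
  distance \<open>n - 3\<close>, is the vertex two steps after \<open>p\<close>.\<close>

lemma iso_theta_0_2:
  assumes n: "n \<ge> 5" "card (verts G) = n" and d: "d p = n - 1" "d q = n - 3"
  shows "digraph_iso G (theta 0 2 (n - 4))"
proof -
  \<comment> \<open>Positions, counted from 0, on the spanning path 2, 3, 0, 4, ...,
    \<open>n - 1\<close>, 1 of the theta digraph.\<close>
  define e where "e x = (if x = 0 then 2 else if x = 1 then n - 1 else if x < 4 then x - 2
    else x - 1)" for x :: nat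
  define f where "f x = (s ^^ e x) p" for x
  have e: "e x < n" if "x < n" for x using that n by (auto simp: e_def)
  have f: "f x \<in> verts G \<and> d (f x) = n - 1 - e x" if "x < n" for x
    using funpow_s[OF pq_in(1), of "e x"] e[OF that] d by (auto simp: f_def)
  have inj: "inj_on f {0..<n}"
  proof (rule inj_onI)
    fix x y assume xy: "x \<in> {0..<n}" "y \<in> {0..<n}" "f x = f y"
    hence "d (f x) = d (f y)" by simp
    hence "e x = e y" using f[of x] f[of y] e[of x] e[of y] xy by auto
    thus "x = y" using xy n by (auto simp: e_def split: if_splits)
  qed
  have img: "f ` {0..<n} = verts G"
    by (rule card_subset_eq) (use f n card_image[OF inj] in auto)
  have f1: "f 1 = v" using f[of 1] n d_eq_0_iff[of "f 1"] by (simp add: e_def)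
  have "q = (s ^^ (d p - d q)) p" by (rule orbit_spanning) (use pq_in n d in auto)
  moreover have "d p - d q = 2" using n d by simp
  ultimately have f02: "f 0 = q" "f 2 = p" by (simp_all add: f_def e_def)
  have N: "0 + 2 + (n - 4) + 2 = n" using n by simp
  have es: "e (theta_succ 0 2 (n - 4) x) = Suc (e x)" if "x < n" "x \<noteq> 1" for x
    using that n by (auto simp: e_def theta_succ_def)
  show ?thesis
  proof (rule digraph_isoI[where f = f])
    show "digraph G" by (rule digraph_axioms)
    show "digraph (theta 0 2 (n - 4))" "card (arcs (theta 0 2 (n - 4))) = card (arcs G)"
      using sc_bicyclic_theta[of 0 2 "n - 4"] card_arcs n by (auto simp: sc_bicyclic_def)
    show "inj_on f (verts (theta 0 2 (n - 4)))" "f ` verts (theta 0 2 (n - 4)) = verts G"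
      unfolding theta_simps N by (fact inj, fact img)
    fix x y assume "x \<rightarrow>\<^bsub>theta 0 2 (n - 4)\<^esub> y"
    hence "x < n \<and> x \<noteq> 1 \<and> y = theta_succ 0 2 (n - 4) x \<or> x = 1 \<and> (y = 0 \<or> y = 2)"
      unfolding arcs_ends_theta theta_arc_iff N by auto
    thus "f x \<rightarrow> f y"
    proof (elim disjE conjE)
      assume x: "x < n" "x \<noteq> 1" "y = theta_succ 0 2 (n - 4) x"
      have "f x \<noteq> f 1" using inj_onD[OF inj, of x 1] x n by auto
      moreover have "f y = s (f x)" using es x by (simp add: f_def)
      ultimately show ?thesis using f[OF x(1)] f1 dom_s by simp
    qed (auto simp: f02 f1 dom_v simp del: One_nat_def)
  qed
qed

end

section \<open>Classification and order of the smallest radii\<close>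

lemma sc_bicyclic_cases:
  fixes G :: "('a, 'b) pre_digraph"
  assumes \<alpha>: "0 \<le> \<alpha>" "\<alpha> < 1" and n: "n \<ge> 5" and G: "sc_bicyclic n G"
  shows "A_alpha_radius \<alpha> G = A_alpha_radius \<alpha> (theta 0 1 (n - 3)) \<or>
    A_alpha_radius \<alpha> G = A_alpha_radius \<alpha> (theta 1 1 (n - 4)) \<and> digraph_iso G (theta 1 1 (n - 4)) \<or>
    A_alpha_radius \<alpha> G = A_alpha_radius \<alpha> (theta 0 2 (n - 4)) \<and> digraph_iso G (theta 0 2 (n - 4)) \<or>
    A_alpha_radius \<alpha> G > A_alpha_radius \<alpha> (theta 0 2 (n - 4))"
proof -
  define \<beta> where "\<beta> = \<alpha> / (1 - \<alpha>)"
  have \<beta>: "\<beta> \<ge> 0" using \<alpha> by (simp add: \<beta>_def)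
  have cV: "card (verts G) = n" using G by (simp add: sc_bicyclic_def)
  obtain v p0 q0 s d where B0: "branching_digraph G v p0 q0 s d"
    using sc_bicyclic_branching[OF G] n by auto
  obtain p q where B: "branching_digraph G v p q s d" and le: "d q \<le> d p"
  proof (cases "d q0 \<le> d p0")
    case True
    thus ?thesis using that B0 by blast
  next
    case False
    thus ?thesis using that branching_digraph.swap[OF B0] by simp
  qed
  interpret branching_digraph G v p q s d by (rule B)
  obtain t where t: "characteristic_root \<beta> (d p) (d q) t"
    using characteristic_root_exists[OF \<beta>] by blast
  have rG: "A_alpha_radius \<alpha> G = \<alpha> + (1 - \<alpha>) * t" using radius_eq[OF \<alpha>] t by (simp add: \<beta>_def)
  have "d p < n" "d q < n" "Suc (d p) < n \<or> Suc (d q) < n"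
    using d_less_card pq_in d_not_both_maximal cV by auto
  \<comment> \<open>Since \<open>d q \<le> d p\<close> and not both are \<open>n - 1\<close>,
    \<open>d q\<close> is at most \<open>n - 2\<close>. The last case is every pair strictly
    dominated by \<open>(n - 1, n - 3)\<close>, so monotonicity puts its radius above that of
    \<open>theta 0 2 (n - 4)\<close>.\<close>
  then consider (1) "d p = n - 1" "d q = n - 2" | (2) "d p = n - 2" "d q = n - 2"
    | (3) "d p = n - 1" "d q = n - 3" | (4) "d p \<le> n - 1" "d q \<le> n - 3" "d p < n - 1 \<or> d q < n - 3"
    using le by linarith
  thus ?thesis
  proof cases
    case 1
    have "characteristic_root \<beta> (n - 2) (n - 1) t" using t 1 characteristic_root_commute by metis
    moreover have "0 + (n - 3) + 1 = n - 2" "1 + (n - 3) + 1 = n - 1" using n by auto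
    ultimately have "A_alpha_radius \<alpha> (theta 0 1 (n - 3)) = \<alpha> + (1 - \<alpha>) * t"
      using A_alpha_radius_theta[OF \<alpha>, of 0 1 "n - 3" t] by (simp only: \<beta>_def)
    thus ?thesis using rG by simp
  next
    case 2
    moreover have "1 + (n - 4) + 1 = n - 2" using n by simp
    ultimately have "A_alpha_radius \<alpha> (theta 1 1 (n - 4)) = \<alpha> + (1 - \<alpha>) * t"
      using A_alpha_radius_theta[OF \<alpha>, of 1 1 "n - 4" t] t by (simp only: \<beta>_def)
    thus ?thesis using rG iso_theta_1_1[OF n cV 2] by simp
  next
    case 3
    have "characteristic_root \<beta> (n - 3) (n - 1) t" using t 3 characteristic_root_commute by metis
    moreover have "0 + (n - 4) + 1 = n - 3" "2 + (n - 4) + 1 = n - 1" using n by auto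
    ultimately have "A_alpha_radius \<alpha> (theta 0 2 (n - 4)) = \<alpha> + (1 - \<alpha>) * t"
      using A_alpha_radius_theta[OF \<alpha>, of 0 2 "n - 4" t] by (simp only: \<beta>_def)
    thus ?thesis using rG iso_theta_0_2[OF n cV 3] by simp
  next
    case 4
    obtain u where u: "characteristic_root \<beta> (n - 3) (n - 1) u"
      using characteristic_root_exists[OF \<beta>] by blast
    moreover have "0 + (n - 4) + 1 = n - 3" "2 + (n - 4) + 1 = n - 1" using n by auto
    ultimately have "A_alpha_radius \<alpha> (theta 0 2 (n - 4)) = \<alpha> + (1 - \<alpha>) * u"
      using A_alpha_radius_theta[OF \<alpha>, of 0 2 "n - 4" u] by (simp only: \<beta>_def)
    moreover have "u < t"
      using characteristic_root_antimono[of \<beta> "n - 1" "n - 3" u] u t 4 characteristic_root_commute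
      by metis
    ultimately show ?thesis using rG \<alpha> by simp
  qed
qed

lemma theta_radii_less:
  assumes \<alpha>: "0 \<le> \<alpha>" "\<alpha> < 1" and n: "n \<ge> 5"
  shows "A_alpha_radius \<alpha> (theta 0 1 (n - 3)) < A_alpha_radius \<alpha> (theta 1 1 (n - 4))"
    and "A_alpha_radius \<alpha> (theta 1 1 (n - 4)) < A_alpha_radius \<alpha> (theta 0 2 (n - 4))"
proof -
  define \<beta> where "\<beta> = \<alpha> / (1 - \<alpha>)"
  have \<beta>: "\<beta> \<ge> 0" using \<alpha> by (simp add: \<beta>_def)
  \<comment> \<open>The three exponent pairs become \<open>(m + 1, m + 2)\<close>,
    \<open>(m + 1, m + 1)\<close> and \<open>(m, m + 2)\<close>: monotonicity separates the first
    two, convexity the last two.\<close>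
  define m where "m = n - 3"
  have m: "n - 3 = m" "0 + (n - 3) + 1 = Suc m" "1 + (n - 3) + 1 = Suc (Suc m)"
    "0 + (n - 4) + 1 = m" "1 + (n - 4) + 1 = Suc m" "2 + (n - 4) + 1 = Suc (Suc m)"
    using n by (auto simp: m_def)
  obtain t1 t2 t3 where t: "characteristic_root \<beta> (Suc m) (Suc (Suc m)) t1"
    "characteristic_root \<beta> (Suc m) (Suc m) t2" "characteristic_root \<beta> m (Suc (Suc m)) t3"
    using characteristic_root_exists[OF \<beta>] by meson
  have "t1 < t2" by (rule characteristic_root_antimono[OF t(1,2)]) auto
  moreover have "t2 < t3" by (rule characteristic_root_spread[OF t(2,3)])
  moreover have "A_alpha_radius \<alpha> (theta 0 1 (n - 3)) = \<alpha> + (1 - \<alpha>) * t1"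
    "A_alpha_radius \<alpha> (theta 1 1 (n - 4)) = \<alpha> + (1 - \<alpha>) * t2"
    "A_alpha_radius \<alpha> (theta 0 2 (n - 4)) = \<alpha> + (1 - \<alpha>) * t3"
    by (rule A_alpha_radius_theta; use \<alpha> t m in \<open>simp add: \<beta>_def\<close>)+
  ultimately show "A_alpha_radius \<alpha> (theta 0 1 (n - 3)) < A_alpha_radius \<alpha> (theta 1 1 (n - 4))"
    "A_alpha_radius \<alpha> (theta 1 1 (n - 4)) < A_alpha_radius \<alpha> (theta 0 2 (n - 4))"
    using \<alpha> by simp_all
qed

theorem theorem2p12:
  fixes \<alpha> :: real and n :: nat
  assumes "0 \<le> \<alpha>" and "\<alpha> < 1" and "n \<ge> 5"
  shows
    "sc_bicyclic n (theta 0 1 (n - 3)) \<and>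
     kth_minimum 1 (A_alpha_radii \<alpha> n) (A_alpha_radius \<alpha> (theta 0 1 (n - 3))) \<and>
     sc_bicyclic n (theta 1 1 (n - 4)) \<and>
     kth_minimum 2 (A_alpha_radii \<alpha> n) (A_alpha_radius \<alpha> (theta 1 1 (n - 4))) \<and>
     (\<forall>G :: ('a, 'b) pre_digraph.
        sc_bicyclic n G \<and> kth_minimum 2 (A_alpha_radii \<alpha> n) (A_alpha_radius \<alpha> G)
        \<longrightarrow> digraph_iso G (theta 1 1 (n - 4))) \<and>
     sc_bicyclic n (theta 0 2 (n - 4)) \<and>
     kth_minimum 3 (A_alpha_radii \<alpha> n) (A_alpha_radius \<alpha> (theta 0 2 (n - 4))) \<and>
     (\<forall>G :: ('a, 'b) pre_digraph.
        sc_bicyclic n G \<and> kth_minimum 3 (A_alpha_radii \<alpha> n) (A_alpha_radius \<alpha> G)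
        \<longrightarrow> digraph_iso G (theta 0 2 (n - 4)))"
proof -
  define S where "S = A_alpha_radii \<alpha> n"
  define r1 where "r1 = A_alpha_radius \<alpha> (theta 0 1 (n - 3))"
  define r2 where "r2 = A_alpha_radius \<alpha> (theta 1 1 (n - 4))"
  define r3 where "r3 = A_alpha_radius \<alpha> (theta 0 2 (n - 4))"
  have lt: "r1 < r2" "r2 < r3" using theta_radii_less assms by (auto simp: r1_def r2_def r3_def)
  have bi: "sc_bicyclic n (theta 0 1 (n - 3))" "sc_bicyclic n (theta 1 1 (n - 4))"
    "sc_bicyclic n (theta 0 2 (n - 4))"
  proof -
    have N: "0 + 1 + (n - 3) + 2 = n" "1 + 1 + (n - 4) + 2 = n" "0 + 2 + (n - 4) + 2 = n"
      using assms(3) by auto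
    show "sc_bicyclic n (theta 0 1 (n - 3))" "sc_bicyclic n (theta 1 1 (n - 4))"
      "sc_bicyclic n (theta 0 2 (n - 4))"
      using sc_bicyclic_theta[of 0 1 "n - 3", unfolded N] sc_bicyclic_theta[of 1 1 "n - 4", unfolded N]
        sc_bicyclic_theta[of 0 2 "n - 4", unfolded N] by simp_all
  qed
  have mem: "r1 \<in> S" "r2 \<in> S" "r3 \<in> S"
    using bi[THEN A_alpha_radius_in_radii, of \<alpha>] by (simp_all add: S_def r1_def r2_def r3_def)
  \<comment> \<open>Here the classification is applied to digraphs on naturals, for
    \<open>iso\<close> and \<open>iso'\<close> to those of the type of \<open>G\<close>.\<close>
  have S: "y = r1 \<or> y = r2 \<or> y = r3 \<or> y > r3" if "y \<in> S" for y
    using that sc_bicyclic_cases[OF assms]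
    unfolding S_def A_alpha_radii_def r1_def r2_def r3_def by blast
  have below: "{y \<in> S. y < r1} = {}" "{y \<in> S. y < r2} = {r1}" "{y \<in> S. y < r3} = {r1, r2}"
    using S mem lt by force+
  have kth: "kth_minimum 1 S r1" "kth_minimum 2 S r2" "kth_minimum 3 S r3"
    unfolding kth_minimum_def below using mem lt by simp_all
  \<comment> \<open>If \<open>x < y\<close>, then \<open>x\<close> itself lies below
    \<open>y\<close> but not below \<open>x\<close>, so the two counts differ.\<close>
  have uniq: "x = y" if "kth_minimum k S x" "kth_minimum k S y" for k x y
  proof -
    have "\<not> x < y" if "kth_minimum k S x" "kth_minimum k S y" for x y
    proof
      assume "x < y"
      hence "{z \<in> S. z < x} \<subset> {z \<in> S. z < y}" using that by (auto simp: kth_minimum_def)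
      moreover have "finite {z \<in> S. z < y}" using that by (simp add: kth_minimum_def)
      ultimately have "card {z \<in> S. z < x} < card {z \<in> S. z < y}" by (rule psubset_card_mono[rotated])
      thus False using that by (simp add: kth_minimum_def)
    qed
    from this[OF that] this[OF that(2,1)] show ?thesis by linarith
  qed
  have iso: "digraph_iso G (theta 1 1 (n - 4))"
    if "sc_bicyclic n G" "kth_minimum 2 S (A_alpha_radius \<alpha> G)" for G :: "('a, 'b) pre_digraph"
    using sc_bicyclic_cases[OF assms that(1), folded r1_def r2_def r3_def]
      uniq[OF that(2) kth(2)] lt by auto
  have iso': "digraph_iso G (theta 0 2 (n - 4))"
    if "sc_bicyclic n G" "kth_minimum 3 S (A_alpha_radius \<alpha> G)" for G :: "('a, 'b) pre_digraph"
    using sc_bicyclic_cases[OF assms that(1), folded r1_def r2_def r3_def]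
      uniq[OF that(2) kth(3)] lt by auto
  show ?thesis
    using bi kth iso iso' unfolding S_def r1_def r2_def r3_def by blast
qed

end
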